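(* Let $s,k,n$ be integers and $m\ge 1$. Let $p,q,r,a,b,c$ be real numbers with $c\neq 0$, let $(P_n)_{n\in\mathbb{Z}}=\mathcal{P}(x)(p,q,r;a,b,c)$, $(U_n)_{n\in\mathbb{Z}}=\mathcal{P}(x)(0,0,1;a,b,c)$, and $\Delta_{\mathcal{P}}=(q^2-apq)x^2+(2qr-apr-bpq)x+(r^2-bpr-cp^2)$. Let $d_1,\dots,d_m$ and $e_1,\dots,e_m$ be integers. Then \[ \det\Big(\Big[\prod_{f=j+1}^m P_{s+k(n+i+d_f)}\prod_{g=1}^j P_{s+k(n+i+e_g)}\Big]_{0\le i,j\le m}\Big) = (-\Delta_{\mathcal{P}})^{\binom{m+1}{2}}(-c)^{(s+kn)\binom{m+1}{2}+k\binom{m+1}{3}}\prod_{l=1}^m U_{kl}^{m+1-l}\cdot\prod_{1\le i\le j\le m}(-c)^{kd_j}U_{k(e_i-d_j)}. \]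
   Context: For real numbers $p,q,r,a,b,c$ with $c\neq 0$, $\mathcal{P}(x)(p,q,r;a,b,c)=(P_n)_{n\in\mathbb{Z}}$ denotes the sequence of polynomials in $x$ defined by $P_0=p$, $P_1=qx+r$, $P_{n+2}=(ax+b)P_{n+1}+cP_n$ for $n\ge 0$, and for $n<0$ by $P_n=-\frac{ax+b}{c}P_{n+1}+\frac{1}{c}P_{n+2}$; so $U_0=0$, $U_1=1$. $[M_{i,j}]_{0\le i,j\le m}$ is the $(m+1)\times(m+1)$ matrix with entry $M_{i,j}$ in row $i$, column $j$; empty products equal $1$. *)

theory Defs
  imports
    "HOL-Computational_Algebra.Polynomial"
    "Jordan_Normal_Form.Determinant"
begin

text \<open>
  The two-sided sequence with parameters \<open>(p, q, r; a, b, c)\<close> as polynomials in \<open>x\<close>;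
  note that \<open>[:v, u:]\<close> is the polynomial \<open>u x + v\<close>. It is meant for \<open>c \<noteq> 0\<close>.
\<close>

function poly_seq :: "real \<Rightarrow> real \<Rightarrow> real \<Rightarrow> real \<Rightarrow> real \<Rightarrow> real \<Rightarrow> int \<Rightarrow> real poly" where
  "poly_seq p q r a b c n =
     (if n = 0 then [:p:]
      else if n = 1 then [:r, q:]
      else if n > 1 then
        [:b, a:] * poly_seq p q r a b c (n - 1) + [:c:] * poly_seq p q r a b c (n - 2)
      else
        - ([:b / c, a / c:] * poly_seq p q r a b c (n + 1))
          + [:1 / c:] * poly_seq p q r a b c (n + 2))"
  by auto
termination
  by (relation "measure (\<lambda>(p, q, r, a, b, c, n). nat \<bar>2 * n - 1\<bar>)") auto

declare poly_seq.simps [simp del]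

lemma poly_seq_0: "poly_seq p q r a b c 0 = [:p:]"
  by (simp add: poly_seq.simps)

lemma poly_seq_1: "poly_seq p q r a b c 1 = [:r, q:]"
  by (simp add: poly_seq.simps)

lemma poly_seq_nonneg:
  assumes "n \<ge> 0"
  shows "poly_seq p q r a b c (n + 2) =
    [:b, a:] * poly_seq p q r a b c (n + 1) + [:c:] * poly_seq p q r a b c n"
  using assms by (subst poly_seq.simps) (simp add: add.commute)

lemma poly_seq_neg:
  assumes "n < 0"
  shows "poly_seq p q r a b c n =
    - ([:b / c, a / c:] * poly_seq p q r a b c (n + 1)) + [:1 / c:] * poly_seq p q r a b c (n + 2)"
  using assms by (subst poly_seq.simps) simp

definition poly_seq_Delta :: "real \<Rightarrow> real \<Rightarrow> real \<Rightarrow> real \<Rightarrow> real \<Rightarrow> real \<Rightarrow> real poly" where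
  "poly_seq_Delta p q r a b c =
     [:r\<^sup>2 - b * p * r - c * p\<^sup>2, 2 * q * r - a * p * r - b * p * q, q\<^sup>2 - a * p * q:]"

end

theory Submission
  imports Defs
begin

text \<open>
  Since \<open>P\<^bsub>N+t\<^esub> = P\<^bsub>N+1\<^esub> U\<^bsub>t\<^esub> + c P\<^bsub>N\<^esub> U\<^bsub>t-1\<^esub>\<close>, every factor in row \<open>i\<close> is a linear form, with
  coefficients \<open>(c U\<^bsub>t-1\<^esub>, U\<^bsub>t\<^esub>)\<close>, evaluated at the point \<open>(P\<^bsub>N\<^esub>, P\<^bsub>N+1\<^esub>)\<close> for \<open>N = s + k(n + i)\<close>.
  A homogeneous version of Krattenthaler's determinant lemma evaluates such a determinant of products
  of binary linear forms as a product of \<open>2 \<times> 2\<close> determinants of points and of coefficient vectors,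
  and each of these is given by d'Ocagne's identity
  \<open>P\<^bsub>M\<^esub> P\<^bsub>N+1\<^esub> - P\<^bsub>N\<^esub> P\<^bsub>M+1\<^esub> = -\<Delta> (-c)\<^bsup>M\<^esup> U\<^bsub>N-M\<^esub>\<close>.
\<close>

section \<open>Determinants of products of binary linear forms\<close>

definition dot2 :: "'a::comm_ring_1 \<times> 'a \<Rightarrow> 'a \<times> 'a \<Rightarrow> 'a" where
  "dot2 u v = fst u * fst v + snd u * snd v"

definition det2 :: "'a::comm_ring_1 \<times> 'a \<Rightarrow> 'a \<times> 'a \<Rightarrow> 'a" where
  "det2 u v = fst u * snd v - fst v * snd u"

lemma dot2_mult_diff: "dot2 u a * dot2 v b - dot2 u b * dot2 v a = det2 u v * det2 a b"
  by (simp add: dot2_def det2_def algebra_simps)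

lemma det2_swap: "det2 v u = - det2 u v"
  by (simp add: det2_def)

lemma det_scale_rows_cols:
  fixes A :: "nat \<Rightarrow> nat \<Rightarrow> 'a::comm_ring_1"
  shows "det (mat n n (\<lambda>(i, j). u i * v j * A i j)) =
    (\<Prod>i<n. u i) * (\<Prod>j<n. v j) * det (mat n n (\<lambda>(i, j). A i j))"
proof -
  have "signof \<pi> * (\<Prod>i = 0..<n. u i * v (\<pi> i) * A i (\<pi> i)) =
      (\<Prod>i<n. u i) * (\<Prod>j<n. v j) * (signof \<pi> * (\<Prod>i = 0..<n. A i (\<pi> i)))"
    if "\<pi> permutes {0..<n}" for \<pi>
  proof -
    have "(\<Prod>i = 0..<n. v (\<pi> i)) = (\<Prod>i = 0..<n. v i)"
      using prod.permute[OF that, of v] by (simp add: o_def)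
    then show ?thesis
      by (simp add: prod.distrib lessThan_atLeast0 mult_ac)
  qed
  then show ?thesis
    by (subst (1 2) det_def'[where n = n])
      (auto simp: sum_distrib_left permutes_in_image intro!: sum.cong prod.cong)
qed

lemma det_combine_adjacent_cols:
  fixes A :: "nat \<Rightarrow> nat \<Rightarrow> 'a::comm_ring_1"
  shows "det (mat (Suc n) (Suc n)
      (\<lambda>(i, j). if j < n then p j * A i j + q j * A i (Suc j) else A i j)) =
    (\<Prod>j<n. p j) * det (mat (Suc n) (Suc n) (\<lambda>(i, j). A i j))"
    (is "det ?C = _ * det ?A")
proof -
  define B where "B = mat (Suc n) (Suc n)
    (\<lambda>(i, j). if i = j then (if j < n then p j else 1) else if i = Suc j then q j else 0)"
  have B: "B \<in> carrier_mat (Suc n) (Suc n)"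
    by (simp add: B_def)
  have "?C = ?A * B"
  proof (rule eq_matI)
    fix i j
    assume "i < dim_row (?A * B)" and "j < dim_col (?A * B)"
    then have i: "i < Suc n" and j: "j < Suc n"
      by (simp_all add: B_def)
    have "(?A * B) $$ (i, j) = (\<Sum>l<Suc n. A i l * B $$ (l, j))"
      using i j by (simp add: B_def scalar_prod_def lessThan_atLeast0)
    also have "\<dots> = (\<Sum>l\<in>(if j < n then {j, Suc j} else {j}). A i l * B $$ (l, j))"
      using j by (intro sum.mono_neutral_right) (auto simp: B_def)
    also have "\<dots> = ?C $$ (i, j)"
      using i j by (auto simp: B_def mult.commute)
    finally show "?C $$ (i, j) = (?A * B) $$ (i, j)" ..
  qed (simp_all add: B_def)
  moreover have "det B = (\<Prod>j<n. p j)"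
    by (subst det_lower_triangular[OF _ B]) (auto simp: B_def prod_list_diag_prod lessThan_atLeast0)
  ultimately show ?thesis
    using det_mult[OF _ B, of ?A] by (simp add: mult.commute)
qed

lemma det_first_row_zero_except_last:
  fixes A :: "nat \<Rightarrow> nat \<Rightarrow> 'a::comm_ring_1"
  assumes "\<And>j. j < n \<Longrightarrow> A 0 j = 0"
  shows "det (mat (Suc n) (Suc n) (\<lambda>(i, j). A i j)) =
    (- 1) ^ n * A 0 n * det (mat n n (\<lambda>(i, j). A (Suc i) j))"
proof -
  let ?A = "mat (Suc n) (Suc n) (\<lambda>(i, j). A i j)"
  have minor: "mat_delete ?A 0 n = mat n n (\<lambda>(i, j). A (Suc i) j)"
    by (rule eq_matI) (auto simp: mat_delete_def)
  have "det ?A = (\<Sum>j<Suc n. ?A $$ (0, j) * cofactor ?A 0 j)"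
    by (rule laplace_expansion_row) simp_all
  also have "\<dots> = (\<Sum>j\<in>{n}. ?A $$ (0, j) * cofactor ?A 0 j)"
    using assms by (intro sum.mono_neutral_right) auto
  also have "\<dots> = (- 1) ^ n * A 0 n * det (mat n n (\<lambda>(i, j). A (Suc i) j))"
    by (simp add: cofactor_def minor)
  finally show ?thesis .
qed

definition form_prod ::
    "nat \<Rightarrow> (nat \<Rightarrow> 'a::comm_ring_1 \<times> 'a) \<Rightarrow> (nat \<Rightarrow> 'a \<times> 'a) \<Rightarrow> nat \<Rightarrow> 'a \<times> 'a \<Rightarrow> 'a" where
  "form_prod m a b j v = (\<Prod>f = j + 1..m. dot2 v (a f)) * (\<Prod>g = 1..j. dot2 v (b g))"

definition form_prod_mat ::
    "nat \<Rightarrow> (nat \<Rightarrow> 'a::comm_ring_1 \<times> 'a) \<Rightarrow> (nat \<Rightarrow> 'a \<times> 'a) \<Rightarrow> (nat \<Rightarrow> 'a \<times> 'a) \<Rightarrow> 'a mat" where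
  "form_prod_mat m a b v = mat (m + 1) (m + 1) (\<lambda>(i, j). form_prod m a b j (v i))"

lemma form_prod_Suc_left:
  assumes "j \<le> m"
  shows "form_prod (Suc m) a b j v = dot2 v (a (Suc j)) * form_prod m (\<lambda>f. a (Suc f)) b j v"
  using assms prod.atLeast_Suc_atMost[of "Suc j" "Suc m" "\<lambda>f. dot2 v (a f)"]
  by (simp add: form_prod_def prod.shift_bounds_cl_Suc_ivl mult_ac del: prod.cl_ivl_Suc)

lemma form_prod_Suc_right:
  "form_prod (Suc m) a b (Suc j) v = dot2 v (b (Suc j)) * form_prod m (\<lambda>f. a (Suc f)) b j v"
proof -
  have "(\<Prod>f = Suc (Suc j)..Suc m. dot2 v (a f)) = (\<Prod>f = Suc j..m. dot2 v (a (Suc f)))"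
    by (rule prod.shift_bounds_cl_Suc_ivl)
  moreover have "(\<Prod>g = 1..Suc j. dot2 v (b g)) = (\<Prod>g = 1..j. dot2 v (b g)) * dot2 v (b (Suc j))"
    by simp
  ultimately show ?thesis
    by (simp add: form_prod_def mult_ac del: prod.cl_ivl_Suc)
qed

text \<open>
  Adjacent columns share all factors but one, so a combination of them that vanishes in row \<open>0\<close>
  splits off \<open>det2 (v i) (v 0) * det2 (a (j + 1)) (b (j + 1))\<close> and leaves a matrix of the next
  smaller size. The column operations multiply the determinant by the product of the
  \<open>dot2 (v 0) (b g)\<close>, which must be cancelled.
\<close>

lemma det_form_prod_mat_Suc:
  fixes a b v :: "nat \<Rightarrow> 'a::idom \<times> 'a"
  assumes nonzero: "\<And>g. dot2 (v 0) (b g) \<noteq> 0"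
  shows "det (form_prod_mat (Suc m) a b v) =
    (\<Prod>i\<le>m. det2 (v 0) (v (Suc i))) * (\<Prod>j\<le>m. det2 (a (Suc j)) (b (Suc j))) *
    det (form_prod_mat m (\<lambda>f. a (Suc f)) b (\<lambda>i. v (Suc i)))"
proof -
  define entry where "entry i j = form_prod (Suc m) a b j (v i)" for i j
  define combined where "combined i j =
    (if j < Suc m
     then dot2 (v 0) (b (Suc j)) * entry i j + (- dot2 (v 0) (a (Suc j))) * entry i (Suc j)
     else entry i j)" for i j
  let ?D = "\<Prod>j<Suc m. dot2 (v 0) (b (Suc j))" and ?K = "\<Prod>j<Suc m. det2 (a (Suc j)) (b (Suc j))"
  have combined_eq: "combined i j = det2 (v i) (v 0) * det2 (a (Suc j)) (b (Suc j)) *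
      form_prod m (\<lambda>f. a (Suc f)) b j (v i)" if "j < Suc m" for i j
    unfolding dot2_mult_diff [symmetric] using that
    by (simp add: combined_def entry_def form_prod_Suc_left form_prod_Suc_right algebra_simps)
  have "?D * det (form_prod_mat (Suc m) a b v) =
      det (mat (Suc (Suc m)) (Suc (Suc m)) (\<lambda>(i, j). combined i j))"
    unfolding combined_def
    by (subst det_combine_adjacent_cols) (simp add: form_prod_mat_def entry_def [abs_def])
  also have "\<dots> = (- 1) ^ Suc m * combined 0 (Suc m) *
      det (mat (Suc m) (Suc m) (\<lambda>(i, j). combined (Suc i) j))"
    by (rule det_first_row_zero_except_last) (simp add: combined_eq det2_def)
  also have "combined 0 (Suc m) = ?D"
    by (simp add: combined_def entry_def form_prod_def prod.atLeast1_atMost_eq del: prod.cl_ivl_Suc)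
  also have "mat (Suc m) (Suc m) (\<lambda>(i, j). combined (Suc i) j) = mat (Suc m) (Suc m) (\<lambda>(i, j).
      det2 (v (Suc i)) (v 0) * det2 (a (Suc j)) (b (Suc j)) *
      form_prod m (\<lambda>f. a (Suc f)) b j (v (Suc i)))"
    by (rule cong_mat) (simp_all add: combined_eq)
  also have "det \<dots> = (\<Prod>i<Suc m. det2 (v (Suc i)) (v 0)) * ?K *
      det (form_prod_mat m (\<lambda>f. a (Suc f)) b (\<lambda>i. v (Suc i)))"
    by (subst det_scale_rows_cols) (simp add: form_prod_mat_def)
  also have "(\<Prod>i<Suc m. det2 (v (Suc i)) (v 0)) =
      (- 1) ^ Suc m * (\<Prod>i<Suc m. det2 (v 0) (v (Suc i)))"
    by (simp only: det2_swap[of _ "v 0"] prod_uminus card_lessThan)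
  finally have "?D * det (form_prod_mat (Suc m) a b v) = ?D *
      ((\<Prod>i<Suc m. det2 (v 0) (v (Suc i))) * ?K *
       det (form_prod_mat m (\<lambda>f. a (Suc f)) b (\<lambda>i. v (Suc i))))"
    by (simp add: mult_ac flip: power_mult_distrib)
  moreover have "?D \<noteq> 0"
    using nonzero by simp
  ultimately show ?thesis
    by (simp add: lessThan_Suc_atMost)
qed

lemma det_form_prod_mat_nonzero:
  fixes a b v :: "nat \<Rightarrow> 'a::idom \<times> 'a"
  assumes "\<And>i g. dot2 (v i) (b g) \<noteq> 0"
  shows "det (form_prod_mat m a b v) =
    (\<Prod>j\<le>m. \<Prod>i<j. det2 (v i) (v j)) * (\<Prod>j = 1..m. \<Prod>i = 1..j. det2 (a j) (b i))"
  using assms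
proof (induction m arbitrary: a v)
  case 0
  then show ?case
    by (simp add: form_prod_mat_def form_prod_def det_single)
next
  case (Suc m)
  have points: "(\<Prod>j\<le>Suc m. \<Prod>i<j. det2 (v i) (v j)) = (\<Prod>j\<le>m. det2 (v 0) (v (Suc j))) *
      (\<Prod>j\<le>m. \<Prod>i<j. det2 (v (Suc i)) (v (Suc j)))"
    by (simp add: prod.atMost_Suc_shift prod.lessThan_Suc_shift prod.distrib
        del: prod.atMost_Suc prod.lessThan_Suc)
  have "(\<Prod>j = 1..Suc m. \<Prod>i = 1..j. det2 (a j) (b i)) =
      (\<Prod>j\<le>m. det2 (a (Suc j)) (b (Suc j)) * (\<Prod>i = 1..j. det2 (a (Suc j)) (b i)))"
    by (simp add: prod.atLeast1_atMost_eq mult.commute del: prod.cl_ivl_Suc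
        flip: lessThan_Suc_atMost)
  also have "\<dots> = (\<Prod>j\<le>m. det2 (a (Suc j)) (b (Suc j))) *
      (\<Prod>j\<le>m. \<Prod>i = 1..j. det2 (a (Suc j)) (b i))"
    by (rule prod.distrib)
  also have "(\<Prod>j\<le>m. \<Prod>i = 1..j. det2 (a (Suc j)) (b i)) =
      (\<Prod>j = 1..m. \<Prod>i = 1..j. det2 (a (Suc j)) (b i))"
    by (rule prod.mono_neutral_right) (auto simp: not_le)
  finally show ?case
    using Suc.IH[of "\<lambda>i. v (Suc i)" "\<lambda>f. a (Suc f)", OF Suc.prems]
    by (simp only: det_form_prod_mat_Suc[OF Suc.prems] points mult_ac)
qed

lemma det_form_prod_mat:
  fixes a b v :: "nat \<Rightarrow> 'a::idom \<times> 'a"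
  shows "det (form_prod_mat m a b v) =
    (\<Prod>j\<le>m. \<Prod>i<j. det2 (v i) (v j)) * (\<Prod>j = 1..m. \<Prod>i = 1..j. det2 (a j) (b i))"
proof -
  interpret eval0: comm_ring_hom "\<lambda>p :: 'a poly. poly p 0"
    by unfold_locales auto
  \<comment> \<open>Adding an indeterminate \<open>t\<close> to the first coordinates of \<open>v i\<close> and \<open>b g\<close> makes every
    \<open>dot2 (v i) (b g)\<close> monic in \<open>t\<close>, hence nonzero; the identity is then specialised to \<open>t = 0\<close>.\<close>
  define const where "const u = ([:fst u:], [:snd u:])" for u :: "'a \<times> 'a"
  define generic where "generic u = ([:fst u, 1:], [:snd u:])" for u :: "'a \<times> 'a"
  let ?a = "const \<circ> a" and ?b = "generic \<circ> b" and ?v = "generic \<circ> v"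
  have "form_prod_mat m a b v = map_mat (\<lambda>p. poly p 0) (form_prod_mat m ?a ?b ?v)"
    by (rule eq_matI) (auto simp: form_prod_mat_def form_prod_def dot2_def const_def generic_def
        poly_prod mult.commute)
  then have "det (form_prod_mat m a b v) = poly (det (form_prod_mat m ?a ?b ?v)) 0"
    by (simp only: eval0.hom_det)
  also have "det (form_prod_mat m ?a ?b ?v) =
      (\<Prod>j\<le>m. \<Prod>i<j. det2 (?v i) (?v j)) * (\<Prod>j = 1..m. \<Prod>i = 1..j. det2 (?a j) (?b i))"
    by (rule det_form_prod_mat_nonzero) (simp add: dot2_def generic_def)
  also have "poly \<dots> 0 =
      (\<Prod>j\<le>m. \<Prod>i<j. det2 (v i) (v j)) * (\<Prod>j = 1..m. \<Prod>i = 1..j. det2 (a j) (b i))"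
    by (simp add: det2_def const_def generic_def poly_prod mult.commute)
  finally show ?thesis .
qed

section \<open>Two-sided second-order linear recurrences\<close>

definition linear_rec :: "'a::comm_ring_1 \<Rightarrow> 'a \<Rightarrow> (int \<Rightarrow> 'a) \<Rightarrow> bool" where
  "linear_rec A C F \<longleftrightarrow> (\<forall>t. F (t + 2) = A * F (t + 1) + C * F t)"

lemma linear_recD: "linear_rec A C F \<Longrightarrow> F (t + 2) = A * F (t + 1) + C * F t"
  by (simp add: linear_rec_def)

lemma linear_rec_shift: "linear_rec A C F \<Longrightarrow> linear_rec A C (\<lambda>t. F (N + t))"
  by (simp add: linear_rec_def add.assoc [symmetric])

lemma linear_rec_cmult: "linear_rec A C F \<Longrightarrow> linear_rec A C (\<lambda>t. z * F t)"
  by (simp add: linear_rec_def algebra_simps)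

lemma linear_rec_add:
  "linear_rec A C F \<Longrightarrow> linear_rec A C G \<Longrightarrow> linear_rec A C (\<lambda>t. F t + G t)"
  by (simp add: linear_rec_def algebra_simps)

lemma linear_rec_unique:
  fixes C :: "'a::idom"
  assumes F: "linear_rec A C F" and G: "linear_rec A C G" and "C \<noteq> 0"
    and "F 0 = G 0" "F 1 = G 1"
  shows "F t = G t"
proof -
  have "F t = G t \<and> F (t + 1) = G (t + 1)"
  proof (induction t rule: int_induct[where k = 0])
    case base
    then show ?case using assms by simp
  next
    case (step1 i)
    then show ?case using linear_recD[OF F, of i] linear_recD[OF G, of i] by (simp add: add.assoc)
  next
    case (step2 i)
    then show ?case using linear_recD[OF F, of "i - 1"] linear_recD[OF G, of "i - 1"] \<open>C \<noteq> 0\<close>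
      by (simp add: add.commute)
  qed
  then show ?thesis ..
qed

definition consec :: "(int \<Rightarrow> 'a) \<Rightarrow> int \<Rightarrow> 'a \<times> 'a" where
  "consec F t = (F t, F (t + 1))"

lemma det2_consec_step:
  assumes F: "linear_rec A C F" and G: "linear_rec A C G"
  shows "det2 (consec F (M + 1)) (consec G (N + 1)) = - C * det2 (consec F M) (consec G N)"
  using linear_recD[OF F, of M] linear_recD[OF G, of N]
  by (simp add: det2_def consec_def algebra_simps)

locale fundamental_sequence =
  fixes A C :: "'a::idom" and U :: "int \<Rightarrow> 'a"
  assumes linear_rec_U: "linear_rec A C U" and U_0: "U 0 = 0" and U_1: "U 1 = 1"
    and C_nonzero: "C \<noteq> 0"
begin

definition shift_coeffs :: "int \<Rightarrow> 'a \<times> 'a" where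
  "shift_coeffs t = (C * U (t - 1), U t)"

lemma linear_rec_add_index:
  assumes F: "linear_rec A C F"
  shows "F (N + t) = dot2 (consec F N) (shift_coeffs t)"
proof -
  have "F (N + t) = F N * (C * U (- 1 + t)) + F (N + 1) * U t"
  proof (rule linear_rec_unique[where F = "\<lambda>t. F (N + t)"])
    show "linear_rec A C (\<lambda>t. F (N + t))"
      by (rule linear_rec_shift[OF F])
    show "linear_rec A C (\<lambda>t. F N * (C * U (- 1 + t)) + F (N + 1) * U t)"
      by (intro linear_rec_add linear_rec_cmult linear_rec_shift linear_rec_U)
    have "C * U (- 1) = 1"
      using linear_recD[OF linear_rec_U, of "- 1"] by (simp add: U_0 U_1)
    then show "F (N + 0) = F N * (C * U (- 1 + 0)) + F (N + 1) * U 0"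
      by (simp add: U_0)
    show "F (N + 1) = F N * (C * U (- 1 + 1)) + F (N + 1) * U 1"
      by (simp add: U_0 U_1)
  qed (rule C_nonzero)
  then show ?thesis
    by (simp add: dot2_def consec_def shift_coeffs_def)
qed

lemma det2_consec:
  assumes F: "linear_rec A C F"
  shows "det2 (consec F M) (consec F N) = det2 (consec F M) (consec F (M + 1)) * U (N - M)"
  using linear_rec_add_index[OF F, of M "N - M"] linear_rec_add_index[OF F, of "M + 1" "N - M"]
  by (simp add: det2_def dot2_def consec_def shift_coeffs_def algebra_simps)

lemma det2_shift_coeffs:
  "det2 (shift_coeffs t) (shift_coeffs u) = - det2 (consec U t) (consec U (t + 1)) * U (u - t)"
proof -
  have "det2 (shift_coeffs t) (shift_coeffs u) = C * det2 (consec U (t - 1)) (consec U (u - 1))"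
    by (simp add: det2_def shift_coeffs_def consec_def algebra_simps)
  also have "\<dots> = - det2 (consec U t) (consec U u)"
    using det2_consec_step[OF linear_rec_U linear_rec_U, of "t - 1" "u - 1"] by simp
  also have "\<dots> = - det2 (consec U t) (consec U (t + 1)) * U (u - t)"
    using det2_consec[OF linear_rec_U, of t u] by simp
  finally show ?thesis .
qed

end

lemma geometric_int_sequence_poly:
  fixes W :: "int \<Rightarrow> 'a::field poly"
  assumes "z \<noteq> 0" and step: "\<And>t. W (t + 1) = [:z:] * W t"
  shows "W t = W 0 * [:z powi t:]"
proof (induction t rule: int_induct[where k = 0])
  case base
  show ?case by simp
next
  case (step1 i)
  then show ?case
    using \<open>z \<noteq> 0\<close> step[of i] by (simp add: power_int_add)
next
  case (step2 i)
  have "smult z (W (i - 1)) = smult z (W 0 * [:z powi (i - 1):])"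
    using step2 \<open>z \<noteq> 0\<close> step[of "i - 1"] by (simp add: power_int_diff)
  then show ?case
    using \<open>z \<noteq> 0\<close> by (simp add: smult_cancel)
qed

section \<open>The polynomial sequences\<close>

lemma linear_rec_poly_seq:
  assumes "c \<noteq> 0"
  shows "linear_rec [:b, a:] [:c:] (poly_seq p q r a b c)"
  unfolding linear_rec_def
proof
  fix t :: int
  let ?P = "poly_seq p q r a b c"
  show "?P (t + 2) = [:b, a:] * ?P (t + 1) + [:c:] * ?P t"
  proof (cases "t \<ge> 0")
    case True
    then show ?thesis by (rule poly_seq_nonneg)
  next
    case False
    then have "[:c:] * ?P t = - ([:c:] * [:b / c, a / c:] * ?P (t + 1)) + [:c:] * [:1 / c:] * ?P (t + 2)"
      by (subst poly_seq_neg) (simp_all only: not_le algebra_simps)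
    also have "[:c:] * [:b / c, a / c:] = [:b, a:]"
      using assms by simp
    also have "[:c:] * [:1 / c:] = 1"
      using assms by (simp add: one_pCons)
    finally show ?thesis by simp
  qed
qed

lemma fundamental_sequence_poly_seq:
  assumes "c \<noteq> 0"
  shows "fundamental_sequence [:b, a:] [:c:] (poly_seq 0 0 1 a b c)"
  using assms
  by unfold_locales (simp_all add: linear_rec_poly_seq poly_seq_0 poly_seq_1 one_pCons)

lemma det2_consec_Suc_poly_seq:
  fixes p q r a b c :: real
  assumes "c \<noteq> 0"
  defines "P \<equiv> poly_seq p q r a b c"
  shows "det2 (consec P t) (consec P (t + 1)) = - poly_seq_Delta p q r a b c * [:(- c) powi t:]"
proof -
  define W where "W t = det2 (consec P t) (consec P (t + 1))" for t
  have P: "linear_rec [:b, a:] [:c:] P"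
    unfolding P_def by (rule linear_rec_poly_seq) fact
  have "W (t + 1) = [:- c:] * W t" for t
    unfolding W_def by (subst det2_consec_step[OF P P]) simp
  then have "W t = W 0 * [:(- c) powi t:]"
    using \<open>c \<noteq> 0\<close> by (intro geometric_int_sequence_poly) simp_all
  moreover have "P 0 = [:p:]" "P 1 = [:r, q:]" "P 2 = [:b, a:] * [:r, q:] + [:c:] * [:p:]"
    using linear_recD[OF P, of 0] by (simp_all add: P_def poly_seq_0 poly_seq_1)
  then have "W 0 = - poly_seq_Delta p q r a b c"
    by (simp add: W_def det2_def consec_def poly_seq_Delta_def power2_eq_square algebra_simps)
  ultimately show ?thesis
    by (simp only: W_def)
qed

section \<open>Products over triangles\<close>

lemma prod_const_poly_power_int:
  fixes z :: "'a::field"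
  assumes "z \<noteq> 0"
  shows "(\<Prod>i\<in>I. [:z powi h i:]) = [:z powi (\<Sum>i\<in>I. h i):]"
  using assms by (induction I rule: infinite_finite_induct) (simp_all add: power_int_add one_pCons)

lemma sum_triangle_linear:
  fixes u w :: "'a::comm_ring_1"
  shows "(\<Sum>j\<le>m. \<Sum>i<j. u + w * of_nat i) =
    u * of_nat ((m + 1) choose 2) + w * of_nat ((m + 1) choose 3)"
proof -
  have "(\<Sum>i<j. u + w * of_nat i) = u * of_nat (j choose 1) + w * of_nat (j choose 2)" for j
    by (induction j) (simp_all add: numeral_2_eq_2 algebra_simps)
  then have "(\<Sum>j\<le>m. \<Sum>i<j. u + w * of_nat i) =
      (\<Sum>j\<le>m. u * of_nat (j choose 1) + w * of_nat (j choose 2))"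
    by (simp only:)
  also have "\<dots> = u * of_nat (\<Sum>j\<le>m. j choose 1) + w * of_nat (\<Sum>j\<le>m. j choose 2)"
    by (simp only: sum.distrib sum_distrib_left of_nat_sum)
  also have "\<dots> = u * of_nat ((m + 1) choose 2) + w * of_nat ((m + 1) choose 3)"
    unfolding sum_choose_upper by (simp add: numeral_2_eq_2 numeral_3_eq_3)
  finally show ?thesis .
qed

lemma prod_triangle_const:
  fixes z :: "'a::comm_monoid_mult"
  shows "(\<Prod>j\<le>m. \<Prod>i<j. z) = z ^ ((m + 1) choose 2)"
  using sum_choose_upper[of 1 m] by (simp add: numeral_2_eq_2 flip: power_sum)

lemma prod_triangle_diff:
  fixes h :: "nat \<Rightarrow> 'a::comm_monoid_mult"
  shows "(\<Prod>j\<le>m. \<Prod>i<j. h (j - i)) = (\<Prod>l = 1..m. h l ^ (m + 1 - l))"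
proof (induction m)
  case (Suc m)
  have "(\<Prod>i<Suc m. h (Suc m - i)) = (\<Prod>l = 1..Suc m. h l)"
    by (rule prod.reindex_bij_witness[of _ "\<lambda>l. Suc m - l" "\<lambda>i. Suc m - i"]) auto
  then have "(\<Prod>j\<le>Suc m. \<Prod>i<j. h (j - i)) =
      (\<Prod>l = 1..Suc m. h l ^ (m + 1 - l)) * (\<Prod>l = 1..Suc m. h l)"
    using Suc.IH by simp
  also have "\<dots> = (\<Prod>l = 1..Suc m. h l ^ (Suc m + 1 - l))"
    unfolding prod.distrib [symmetric]
    by (rule prod.cong) (auto simp: Suc_diff_le mult.commute simp flip: power_Suc)
  finally show ?case .
qed simp

lemma prod_triangle_pairs:
  fixes h :: "nat \<Rightarrow> nat \<Rightarrow> 'a::comm_monoid_mult"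
  shows
  "(\<Prod>j = 1..m. \<Prod>i = 1..j. h i j) = (\<Prod>(i, j) \<in> {(i, j). 1 \<le> i \<and> i \<le> j \<and> j \<le> m}. h i j)"
proof -
  have "(\<Prod>j = 1..m. \<Prod>i = 1..j. h i j) = (\<Prod>(j, i) \<in> Sigma {1..m} (\<lambda>j. {1..j}). h i j)"
    by (rule prod.Sigma) auto
  also have "\<dots> = (\<Prod>(i, j) \<in> {(i, j). 1 \<le> i \<and> i \<le> j \<and> j \<le> m}. h i j)"
    by (rule prod.reindex_bij_witness[of _ prod.swap prod.swap]) auto
  finally show ?thesis .
qed

lemma prod_triangle_geometric:
  fixes D :: "'a::field poly" and U :: "int \<Rightarrow> 'a poly" and u w :: int
  assumes "z \<noteq> 0"
  shows "(\<Prod>j\<le>m. \<Prod>i<j. D * [:z powi (u + w * int i):] * U (w * (int j - int i))) =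
    D ^ ((m + 1) choose 2) * [:z powi (u * int ((m + 1) choose 2) + w * int ((m + 1) choose 3)):] *
    (\<Prod>l = 1..m. U (w * int l) ^ (m + 1 - l))"
proof -
  have "(\<Prod>j\<le>m. \<Prod>i<j. U (w * (int j - int i))) = (\<Prod>j\<le>m. \<Prod>i<j. U (w * int (j - i)))"
    by (intro prod.cong) (simp_all add: of_nat_diff)
  also have "\<dots> = (\<Prod>l = 1..m. U (w * int l) ^ (m + 1 - l))"
    by (rule prod_triangle_diff)
  finally show ?thesis
    by (simp only: prod.distrib prod_triangle_const prod_const_poly_power_int[OF assms]
        sum_triangle_linear)
qed

theorem theorem3:
  fixes s k n :: int and m :: nat
    and p q r a b c :: real
    and P U :: "int \<Rightarrow> real poly"
    and d e :: "nat \<Rightarrow> int"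
  assumes "m \<ge> 1"
    and "c \<noteq> 0"
    and "P = poly_seq p q r a b c"
    and "U = poly_seq 0 0 1 a b c"
  shows "det (mat (m + 1) (m + 1) (\<lambda>(i, j).
           (\<Prod>f = j + 1..m. P (s + k * (n + int i + d f))) *
           (\<Prod>g = 1..j. P (s + k * (n + int i + e g)))))
       = (- poly_seq_Delta p q r a b c) ^ ((m + 1) choose 2)
         * [:(- c) powi ((s + k * n) * int ((m + 1) choose 2) + k * int ((m + 1) choose 3)):]
         * (\<Prod>l = 1..m. U (k * int l) ^ (m + 1 - l))
         * (\<Prod>(i, j) \<in> {(i, j). 1 \<le> i \<and> i \<le> j \<and> j \<le> m}.
              [:(- c) powi (k * d j):] * U (k * (e i - d j)))"
proof -
  interpret fundamental_sequence "[:b, a:]" "[:c:]" U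
    unfolding assms(4) by (rule fundamental_sequence_poly_seq) fact
  have P: "linear_rec [:b, a:] [:c:] P"
    unfolding assms(3) by (rule linear_rec_poly_seq) fact
  define v where "v i = consec P (s + k * n + k * int i)" for i
  define coeffs where "coeffs t = shift_coeffs (k * t)" for t
  have entry: "P (s + k * (n + int i + t)) = dot2 (v i) (coeffs t)" for i t
    using linear_rec_add_index[OF P, of "s + k * n + k * int i" "k * t"]
    by (simp add: v_def coeffs_def algebra_simps)
  have det2_points: "det2 (v i) (v j) = - poly_seq_Delta p q r a b c *
      [:(- c) powi (s + k * n + k * int i):] * U (k * (int j - int i))" for i j
    unfolding v_def det2_consec[OF P, of _ "s + k * n + k * int j"]
    by (simp add: assms(3) det2_consec_Suc_poly_seq[OF assms(2)] right_diff_distrib)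
  have det2_coeffs: "det2 (coeffs t) (coeffs u) = [:(- c) powi (k * t):] * U (k * (u - t))" for t u
    unfolding coeffs_def det2_shift_coeffs
    by (simp add: assms(4) det2_consec_Suc_poly_seq[OF assms(2)] poly_seq_Delta_def right_diff_distrib)
  have "- c \<noteq> 0"
    using assms(2) by simp
  show ?thesis
    using det_form_prod_mat[of m "coeffs \<circ> d" "coeffs \<circ> e" v]
    by (simp only: form_prod_mat_def form_prod_def o_apply entry det2_points det2_coeffs
        prod_triangle_geometric[OF \<open>- c \<noteq> 0\<close>] prod_triangle_pairs)
qed

end
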